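(* Let $\Psi=(\psi_n)_{n=1}^\infty$ and $\Phi=(\phi_n)_{n=1}^\infty$ be Bessel sequences in separable Hilbert spaces $\mathcal{H}_1$ and $\mathcal{H}_2$, respectively, and let $m=(m_n)_{n=1}^\infty\subseteq\mathbb{C}$ be semi-normalized. Assume that the multiplier $M:=M_{m,\Phi,\Psi}:\mathcal{H}_1\to\mathcal{H}_2$ has closed range, and let $W\subseteq\mathcal{H}_1$, $V\subseteq\mathcal{H}_2$ be closed subspaces with $\mathcal{H}_1=W\oplus\ker(M)$ and $\mathcal{H}_2=\operatorname{ran}(M)\oplus V$. Let $M^{\#}_{W,V}:\mathcal{H}_2\to\mathcal{H}_1$ be the oblique pseudoinverse of $M$ on $W$ along $V$, and put $\Psi^{\#}_{W,V}:=(M^{\#}_{W,V}(m_n\phi_n))_{n=1}^\infty$ and $\Phi^{\#}_{W,V}:=((M^{\#}_{W,V})^*(\overline{m_n}\psi_n))_{n=1}^\infty$. Then the following hold. (i) $M^{\#}_{W,V}=M_{1/m,\Psi^{\#}_{W,V},\Phi^{\mathrm{od}}}$ for any oblique dual frame $\Phi^{\mathrm{od}}$ of $\pi_{\operatorname{ran}(M),V}\Phi$ on $V^\perp$. (ii) $M^{\#}_{W,V}=M_{1/m,\Psi^{\mathrm{od}},\Phi^{\#}_{W,V}}$ for any oblique dual frame $\Psi^{\mathrm{od}}$ of $\pi^*_{W,\ker(M)}\Psi$ on $W$. (iii) $M^{\#}_{W,V}=M_{1/m,\Psi^{\#}_{W,V},\Phi^{\#}_{W,V}}$.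
   Context: Here $X\oplus Y$ denotes a direct sum, not necessarily orthogonal. A sequence $(x_n)$ in a closed subspace $X$ of a Hilbert space $\mathcal{H}$ is a Bessel sequence in $X$ if there is $B>0$ with $\sum_n|\langle h,x_n\rangle|^2\le B\|h\|^2$ for all $h\in X$ (it is then Bessel in $\mathcal{H}$), and a frame for $X$ if moreover $A\|h\|^2\le\sum_n|\langle h,x_n\rangle|^2$ for some $A>0$ and all $h\in X$. For a Bessel sequence $F=(f_n)$ in $\mathcal{H}$, $T_F:\ell^2(\mathbb{N})\to\mathcal{H}$, $T_F(c_n)=\sum_n c_nf_n$, is the synthesis operator; its adjoint is $T_F^*h=(\langle h,f_n\rangle)_n$. For sequences $\Psi$ in $\mathcal{H}_1$, $\Phi$ in $\mathcal{H}_2$ and scalars $m$, the multiplier is $M_{m,\Phi,\Psi}h=\sum_n m_n\langle h,\psi_n\rangle\phi_n$ (second index: synthesis sequence; third index: analysis sequence). For Bessel sequences and bounded $m$ it is a bounded operator $\mathcal{H}_1\to\mathcal{H}_2$. The sequence $m$ is semi-normalized if $0<\inf_n|m_n|\le\sup_n|m_n|<\infty$; $1/m=(1/m_n)_n$. If $\mathcal{H}=X\oplus Z$ with $X,Z$ closed, $\pi_{X,Z}$ is the oblique projection onto $X$ along $Z$: $\pi_{X,Z}(x+z)=x$ for $x\in X$, $z\in Z$. For an operator $L$ and sequence $F=(f_n)$, $LF:=(Lf_n)_n$. Oblique dual frames: let $W_1,W_2$ be closed subspaces of $\mathcal{H}$ with $\mathcal{H}=W_1\oplus W_2^\perp$.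 If $F$ is a frame for $W_1$ and $G$ is a frame for $W_2$, then $F$ is an oblique dual frame of $G$ on $W_1$ if $T_FT_G^*=\pi_{W_1,W_2^\perp}$. (In (i), $W_1=V^\perp$ and $W_2=\operatorname{ran}(M)$; in (ii), $W_1=W$ and $W_2=\ker(M)^\perp$. The sequences $\pi_{\operatorname{ran}(M),V}\Phi$ and $\pi^*_{W,\ker(M)}\Psi$ are frames for $\operatorname{ran}(M)$ and $\ker(M)^\perp$, respectively.) Oblique pseudoinverse: for a bounded operator $M:\mathcal{H}_1\to\mathcal{H}_2$ with closed range and closed subspaces $W,V$ with $\mathcal{H}_1=W\oplus\ker(M)$, $\mathcal{H}_2=\operatorname{ran}(M)\oplus V$, each $y\in\mathcal{H}_2$ can be written as $y=Mx_y+z_y$ with unique $x_y\in W$, $z_y\in V$; the oblique pseudoinverse of $M$ on $W$ along $V$ is $M^{\#}_{W,V}y:=x_y$. It is a bounded linear operator $\mathcal{H}_2\to\mathcal{H}_1$. *)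

theory Defs
  imports "HOL-Analysis.Analysis"
begin

text \<open>
  Complex Hilbert spaces, on top of \<^class>\<open>real_inner\<close>: the underlying real inner product
  is the real part of \<open>cinner\<close>, so norm and topology are those of the real structure and
  \<open>norm x ^ 2 = Re (cinner x x)\<close>. The inner product is linear in its first argument.
  Positive definiteness is inherited from \<^class>\<open>real_inner\<close>.
\<close>

class complex_inner = real_inner +
  fixes scaleC :: "complex \<Rightarrow> 'a \<Rightarrow> 'a"  (infixr \<open>*\<^sub>C\<close> 75)
    and cinner :: "'a \<Rightarrow> 'a \<Rightarrow> complex"
  assumes scaleC_add_right: "a *\<^sub>C (x + y) = a *\<^sub>C x + a *\<^sub>C y"
    and scaleC_add_left: "(a + b) *\<^sub>C x = a *\<^sub>C x + b *\<^sub>C x"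
    and scaleC_scaleC: "a *\<^sub>C b *\<^sub>C x = (a * b) *\<^sub>C x"
    and scaleC_one: "1 *\<^sub>C x = x"
    and scaleR_scaleC: "r *\<^sub>R x = complex_of_real r *\<^sub>C x"
    and cinner_commute: "cinner x y = cnj (cinner y x)"
    and cinner_add_left: "cinner (x + y) z = cinner x z + cinner y z"
    and cinner_scaleC_left: "cinner (a *\<^sub>C x) y = a * cinner x y"
    and inner_Re_cinner: "inner x y = Re (cinner x y)"

class complex_hilbert_space = complex_inner + complete_space

instantiation complex :: complex_hilbert_space
begin

definition scaleC_complex :: "complex \<Rightarrow> complex \<Rightarrow> complex"
  where "scaleC_complex a x = a * x"

definition cinner_complex :: "complex \<Rightarrow> complex \<Rightarrow> complex"
  where "cinner_complex x y = x * cnj y"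

instance
  by standard
    (simp_all add: scaleC_complex_def cinner_complex_def inner_complex_def algebra_simps
      scaleR_conv_of_real)

end

global_interpretation complex_vector:
  vector_space "scaleC :: complex \<Rightarrow> 'a \<Rightarrow> 'a::complex_inner"
  defines csubspace = complex_vector.subspace
  by unfold_locales
    (simp_all add: scaleC_add_right scaleC_add_left scaleC_scaleC scaleC_one)

definition closed_csubspace :: "'a::complex_inner set \<Rightarrow> bool"
  where "closed_csubspace X \<longleftrightarrow> csubspace X \<and> closed X"

definition orth_compl :: "'a::complex_inner set \<Rightarrow> 'a set"
  where "orth_compl X = {h. \<forall>x\<in>X. cinner h x = 0}"

definition ker :: "('a \<Rightarrow> 'b::zero) \<Rightarrow> 'a set"
  where "ker L = {x. L x = 0}"

text \<open>For subspaces \<open>X\<close>, \<open>Z\<close>: the whole space is their (not necessarily orthogonal) direct sum.\<close>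

definition is_direct_sum :: "'a::complex_inner set \<Rightarrow> 'a set \<Rightarrow> bool"
  where "is_direct_sum X Z \<longleftrightarrow> X \<inter> Z = {0} \<and> (\<forall>h. \<exists>x\<in>X. \<exists>z\<in>Z. h = x + z)"

definition oblique_proj :: "'a::complex_inner set \<Rightarrow> 'a set \<Rightarrow> 'a \<Rightarrow> 'a"
  where "oblique_proj X Z h = (THE x. x \<in> X \<and> (\<exists>z\<in>Z. h = x + z))"

text \<open>The Hilbert space adjoint; only meaningful for bounded linear operators, for which the
  operator chosen here exists and is unique.\<close>

definition cadjoint :: "('a::complex_inner \<Rightarrow> 'b::complex_inner) \<Rightarrow> 'b \<Rightarrow> 'a"
  where "cadjoint L = (SOME L'. \<forall>x y. cinner (L x) y = cinner x (L' y))"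

text \<open>The summability conjunct is needed since \<^const>\<open>suminf\<close> is unspecified on divergent series.\<close>

definition bessel_seq_on :: "'a::complex_inner set \<Rightarrow> (nat \<Rightarrow> 'a) \<Rightarrow> bool"
  where "bessel_seq_on X f \<longleftrightarrow> range f \<subseteq> X \<and>
    (\<exists>B>0. \<forall>h\<in>X. summable (\<lambda>n. (cmod (cinner h (f n)))\<^sup>2) \<and>
                 (\<Sum>n. (cmod (cinner h (f n)))\<^sup>2) \<le> B * (norm h)\<^sup>2)"

definition frame_for :: "'a::complex_inner set \<Rightarrow> (nat \<Rightarrow> 'a) \<Rightarrow> bool"
  where "frame_for X f \<longleftrightarrow> bessel_seq_on X f \<and>
    (\<exists>A>0. \<forall>h\<in>X. A * (norm h)\<^sup>2 \<le> (\<Sum>n. (cmod (cinner h (f n)))\<^sup>2))"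

text \<open>The synthesis operator and its adjoint, the analysis operator. They are considered for
  Bessel sequences, where \<open>analysis f\<close> takes values in the square-summable sequences, and
  \<open>synthesis f\<close> is only applied to such sequences.\<close>

definition synthesis :: "(nat \<Rightarrow> 'a::complex_inner) \<Rightarrow> (nat \<Rightarrow> complex) \<Rightarrow> 'a"
  where "synthesis f c = (\<Sum>n. c n *\<^sub>C f n)"

definition analysis :: "(nat \<Rightarrow> 'a::complex_inner) \<Rightarrow> 'a \<Rightarrow> (nat \<Rightarrow> complex)"
  where "analysis f h = (\<lambda>n. cinner h (f n))"

definition multiplier ::
  "(nat \<Rightarrow> complex) \<Rightarrow> (nat \<Rightarrow> 'b::complex_inner) \<Rightarrow> (nat \<Rightarrow> 'a::complex_inner) \<Rightarrow> 'a \<Rightarrow> 'b"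
  where "multiplier m \<phi> \<psi> h = (\<Sum>n. m n *\<^sub>C cinner h (\<psi> n) *\<^sub>C \<phi> n)"

definition semi_normalized :: "(nat \<Rightarrow> complex) \<Rightarrow> bool"
  where "semi_normalized m \<longleftrightarrow> 0 < (INF n. cmod (m n)) \<and> bdd_above (range (\<lambda>n. cmod (m n)))"

text \<open>\<open>oblique_dual_frame W1 W2 F G\<close>: \<open>F\<close> is an oblique dual frame of \<open>G\<close> on \<open>W1\<close>, where \<open>G\<close> is
  a frame for \<open>W2\<close>.\<close>

definition oblique_dual_frame ::
  "'a::complex_inner set \<Rightarrow> 'a set \<Rightarrow> (nat \<Rightarrow> 'a) \<Rightarrow> (nat \<Rightarrow> 'a) \<Rightarrow> bool"
  where "oblique_dual_frame W1 W2 F G \<longleftrightarrow>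
    closed_csubspace W1 \<and> closed_csubspace W2 \<and> is_direct_sum W1 (orth_compl W2) \<and>
    frame_for W1 F \<and> frame_for W2 G \<and>
    synthesis F \<circ> analysis G = oblique_proj W1 (orth_compl W2)"

definition oblique_pinv ::
  "'a::complex_inner set \<Rightarrow> 'b::complex_inner set \<Rightarrow> ('a \<Rightarrow> 'b) \<Rightarrow> 'b \<Rightarrow> 'a"
  where "oblique_pinv W V M y = (THE x. x \<in> W \<and> (\<exists>z\<in>V. y = M x + z))"

end

theory Submission
  imports Defs
begin

text \<open>
  The operator \<open>(x, z) \<mapsto> M x + z\<close> maps \<open>W \<times> V\<close> bijectively onto the target space, so by the open
  mapping theorem \<open>M_sharp\<close> is bounded; hence its adjoint exists and \<open>M_sharp\<close> may be pulled out
  of the series. Then (iii) is the identity \<open>M_sharp \<circ> M \<circ> M_sharp = M_sharp\<close>. For (ii), the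
  oblique projection onto \<open>W\<close> is \<open>M_sharp \<circ> M\<close>, so the series reproduces \<open>M_sharp h \<in> W\<close>. For (i),
  duality against \<open>g \<in> orth_compl V\<close> shows that \<open>\<Sum>n. cinner h (\<Phi>_od n) *\<^sub>C \<Phi> n\<close> differs from \<open>h\<close>
  only by an element of \<open>V\<close>, on which \<open>M_sharp\<close> vanishes.
\<close>

instance complex_hilbert_space \<subseteq> banach ..

section \<open>Open mapping theorem on a closed subspace\<close>

text \<open>Baire's theorem only yields approximate preimages; the factor 1/2 makes the iteration on
  the remainder converge geometrically to an exact one.\<close>

lemma surj_on_subspace_approx_preimage:
  fixes f :: "'a::real_normed_vector \<Rightarrow> 'b::banach"
  assumes f: "bounded_linear f" and S: "subspace S" and surj: "f ` S = UNIV"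
  obtains C where "C \<ge> 0"
    and "\<And>y. \<exists>x\<in>S. norm x \<le> C * norm y \<and> norm (y - f x) \<le> norm y / 2"
proof -
  interpret f: bounded_linear f by (rule f)
  define K where "K n = closure (f ` (S \<inter> cball 0 (real n)))" for n
  have cover: "\<Union>(range K) = UNIV"
  proof -
    have "y \<in> \<Union>(range K)" for y
    proof -
      obtain x where x: "x \<in> S" "f x = y"
        using surj by (metis UNIV_I imageE)
      obtain n where "norm x \<le> real n"
        using real_arch_simple by blast
      then have "y \<in> f ` (S \<inter> cball 0 (real n))"
        using x by (auto simp: image_iff)
      then have "y \<in> K n"
        unfolding K_def by (rule subsetD[OF closure_subset])
      then show ?thesis by blast
    qed
    then show ?thesis by blast
  qed
  have "\<exists>n. interior (K n) \<noteq> {}"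
  proof (rule ccontr)
    assume "\<nexists>n. interior (K n) \<noteq> {}"
    then have "(euclidean :: 'b topology) interior_of \<Union>(range K) = {}"
      by (intro Baire_category_alt)
        (auto simp: completely_metrizable_space_euclidean K_def)
    then show False
      by (simp add: cover)
  qed
  then obtain n y0 where "y0 \<in> interior (K n)"
    by blast
  then obtain r where r: "r > 0" "cball y0 r \<subseteq> K n"
    by (meson mem_interior_cball)
  \<comment> \<open>A small \<open>y\<close> is the difference of \<open>y0 + y\<close> and
    \<open>y0\<close>, which both lie in \<open>K n\<close>. Approximating each to within
    \<open>e / 2\<close> moves the ball around \<open>y0\<close> to a ball around 0, at the price of
    doubling the bound on the preimage.\<close>
  have near: "\<exists>x\<in>S. norm x \<le> 2 * real n \<and> norm (y - f x) < e"
    if y: "norm y \<le> r" and e: "e > 0" for y e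
  proof -
    have "y0 + y \<in> K n" "y0 \<in> K n"
      using r y by (auto simp: subset_iff dist_norm)
    have approx: "\<exists>a\<in>S. norm a \<le> real n \<and> dist (f a) w < e / 2" if "w \<in> K n" for w
      using that e half_gt_zero[OF e] unfolding K_def closure_approachable by fastforce
    obtain a where a: "a \<in> S" "norm a \<le> real n" "dist (f a) (y0 + y) < e / 2"
      using approx[OF \<open>y0 + y \<in> K n\<close>] by blast
    obtain b where b: "b \<in> S" "norm b \<le> real n" "dist (f b) y0 < e / 2"
      using approx[OF \<open>y0 \<in> K n\<close>] by blast
    have "norm (y - f (a - b)) = norm ((y0 + y - f a) - (y0 - f b))"
      by (simp add: f.diff algebra_simps)
    also have "\<dots> \<le> norm (y0 + y - f a) + norm (y0 - f b)"
      by (rule norm_triangle_ineq4)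
    also have "\<dots> < e"
      using a b by (simp add: dist_norm norm_minus_commute)
    finally have "norm (y - f (a - b)) < e" .
    moreover have "norm (a - b) \<le> 2 * real n"
      using norm_triangle_ineq4[of a b] a b by simp
    ultimately show ?thesis
      using a b S by (blast intro: subspace_diff)
  qed
  show ?thesis
  proof
    show "2 * real n / r \<ge> 0"
      using r by simp
    fix y
    show "\<exists>x\<in>S. norm x \<le> (2 * real n / r) * norm y \<and> norm (y - f x) \<le> norm y / 2"
    proof (cases "y = 0")
      case True
      then show ?thesis
        using subspace_0[OF S] by (intro bexI[of _ 0]) (auto simp: f.zero)
    next
      case False
      \<comment> \<open>Scaling by \<open>t\<close> puts \<open>y\<close> on the sphere of radius
        \<open>r\<close>, where \<open>near\<close> applies. The tolerance \<open>r / 2\<close> is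
        chosen to become \<open>norm y / 2\<close> after dividing by \<open>t\<close>.\<close>
      define t where "t = r / norm y"
      have t: "t > 0"
        using False r by (simp add: t_def)
      have "norm (t *\<^sub>R y) \<le> r"
        using False r by (simp add: t_def)
      then obtain x where x: "x \<in> S" "norm x \<le> 2 * real n" "norm (t *\<^sub>R y - f x) < r / 2"
        using near[of "t *\<^sub>R y" "r / 2"] r by auto
      have "norm (y - f (x /\<^sub>R t)) = norm ((t *\<^sub>R y - f x) /\<^sub>R t)"
        using t by (simp add: f.scaleR scaleR_diff_right)
      also have "\<dots> \<le> (r / 2) / t"
        using x t by (simp add: divide_simps)
      also have "\<dots> = norm y / 2"
        using r False by (simp add: t_def)
      finally have 1: "norm (y - f (x /\<^sub>R t)) \<le> norm y / 2" .
      have "norm (x /\<^sub>R t) \<le> (2 * real n) / t"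
        using x t by (simp add: divide_simps)
      also have "\<dots> = (2 * real n / r) * norm y"
        by (simp add: t_def)
      finally show ?thesis
        using 1 x S by (blast intro: subspace_scale)
    qed
  qed
qed

text \<open>The approximate preimages are applied again to each remainder. Remainders halve at every
  step, so the corrections form an absolutely convergent series whose sum stays in the closed set
  \<open>S\<close>; the geometric series turns \<open>C\<close> into \<open>2 * C\<close>.\<close>

lemma surj_on_closed_subspace_bounded_preimage:
  fixes f :: "'a::banach \<Rightarrow> 'b::banach"
  assumes f: "bounded_linear f" and S: "subspace S" "closed S" and surj: "f ` S = UNIV"
  obtains C where "\<And>y. \<exists>x\<in>S. f x = y \<and> norm x \<le> C * norm y"
proof -
  interpret f: bounded_linear f by (rule f)
  obtain C where C: "C \<ge> 0"
    and ex: "\<And>y. \<exists>x\<in>S. norm x \<le> C * norm y \<and> norm (y - f x) \<le> norm y / 2"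
    using surj_on_subspace_approx_preimage[OF f S(1) surj] by metis
  then obtain g where g: "\<And>y. g y \<in> S" "\<And>y. norm (g y) \<le> C * norm y"
    "\<And>y. norm (y - f (g y)) \<le> norm y / 2"
    by metis
  show ?thesis
  proof
    fix y
    \<comment> \<open>\<open>R k\<close> is what remains of \<open>y\<close> after \<open>k\<close>
      corrections, so the images \<open>f (g (R k))\<close> are the successive differences of
      \<open>R\<close> and telescope to \<open>y\<close>.\<close>
    define R where "R k = ((\<lambda>y. y - f (g y)) ^^ k) y" for k
    have R_Suc: "R (Suc k) = R k - f (g (R k))" for k
      by (simp add: R_def)
    have R_le: "norm (R k) \<le> norm y * (1 / 2) ^ k" for k
    proof (induction k)
      case 0
      then show ?case by (simp add: R_def)
    next
      case (Suc k)
      then show ?case using g(3)[of "R k"] by (simp add: R_Suc)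
    qed
    have le: "norm (g (R k)) \<le> C * norm y * (1 / 2) ^ k" for k
      using g(2)[of "R k"] mult_left_mono[OF R_le[of k] C] by (simp add: mult.assoc)
    have sm: "summable (\<lambda>k. C * norm y * (1 / 2 :: real) ^ k)"
      by (intro summable_mult summable_geometric) simp
    have summ_norm: "summable (\<lambda>k. norm (g (R k)))"
      by (rule summable_comparison_test'[OF sm, of 0]) (simp add: le)
    then have summ: "summable (\<lambda>k. g (R k))"
      by (rule summable_norm_cancel)
    define x where "x = (\<Sum>k. g (R k))"
    have "(\<lambda>n. \<Sum>k<n. g (R k)) \<longlonglongrightarrow> x"
      unfolding x_def using summable_LIMSEQ[OF summ] .
    moreover have "(\<Sum>k<n. g (R k)) \<in> S" for n
      using S g by (intro subspace_sum) auto
    ultimately have xS: "x \<in> S"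
      using S(2) unfolding closed_sequential_limits by metis
    have "(\<lambda>k. norm y * (1 / 2) ^ k) \<longlonglongrightarrow> norm y * 0"
      by (intro tendsto_mult tendsto_const LIMSEQ_realpow_zero) auto
    then have "R \<longlonglongrightarrow> 0"
      using Lim_null_comparison[of R "\<lambda>k. norm y * (1 / 2) ^ k" sequentially] R_le by simp
    from telescope_sums'[OF this] have "(\<lambda>k. f (g (R k))) sums y"
      by (simp add: R_Suc) (simp add: R_def)
    moreover have "(\<lambda>k. f (g (R k))) sums f x"
      unfolding x_def using f.sums[OF summable_sums[OF summ]] .
    ultimately have fx: "f x = y"
      by (rule sums_unique2[symmetric])
    have "norm x \<le> (\<Sum>k. norm (g (R k)))"
      unfolding x_def by (rule summable_norm[OF summ_norm])
    also have "\<dots> \<le> (\<Sum>k. C * norm y * (1 / 2) ^ k)"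
      by (intro suminf_le le summ_norm sm)
    also have "\<dots> = 2 * C * norm y"
      by (simp add: suminf_mult suminf_geometric)
    finally show "\<exists>x\<in>S. f x = y \<and> norm x \<le> (2 * C) * norm y"
      using xS fx by blast
  qed
qed

section \<open>Orthogonal projection and adjoints\<close>

text \<open>The point \<open>p\<close> minimizes the distance from \<open>h\<close> to
  \<open>S\<close>. Near-minimizers form nested closed sets \<open>T n\<close>, whose diameters tend
  to 0 by the parallelogram law; completeness gives the minimizer, and its minimality forces
  orthogonality.\<close>

lemma orthogonal_projection_exists:
  fixes S :: "'a::{real_inner, complete_space} set"
  assumes S: "subspace S" "closed S"
  obtains p where "p \<in> S" "\<And>v. v \<in> S \<Longrightarrow> inner (h - p) v = 0"
proof -
  define N where "N p = (norm (h - p))\<^sup>2" for p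
  define d where "d = (INF p\<in>S. N p)"
  have ne: "S \<noteq> {}"
    using subspace_0[OF S(1)] by blast
  have bdd: "bdd_below (N ` S)"
    by (rule bdd_belowI2[of _ 0]) (simp add: N_def)
  have d_le: "d \<le> N p" if "p \<in> S" for p
    unfolding d_def using bdd that by (rule cINF_lower)
  define T where "T n = {p \<in> S. N p \<le> d + 1 / real (Suc n)}" for n
  obtain a where a: "\<And>n. a \<in> T n"
  proof (rule decreasing_closed_nest[of T])
    show "closed (T n)" for n
    proof -
      have "T n = S \<inter> {p. N p \<le> d + 1 / real (Suc n)}"
        by (auto simp: T_def)
      then show ?thesis
        unfolding N_def using S by (auto intro!: closed_Int closed_Collect_le continuous_intros)
    qed
    show "T n \<noteq> {}" for n
    proof -
      have "(INF p\<in>S. N p) < d + 1 / real (Suc n)"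
        by (simp add: d_def)
      then obtain p where "p \<in> S" "N p < d + 1 / real (Suc n)"
        using cINF_less_iff[OF ne bdd] by blast
      then show ?thesis
        by (auto simp: T_def)
    qed
    show "T n \<subseteq> T m" if "m \<le> n" for m n
    proof -
      have "1 / real (Suc n) \<le> 1 / real (Suc m)"
        using that by (intro divide_left_mono) auto
      then show ?thesis
        by (auto simp: T_def)
    qed
    show "\<exists>n. \<forall>x\<in>T n. \<forall>y\<in>T n. dist x y < e" if e: "e > 0" for e
    proof -
      \<comment> \<open>The midpoint of two elements of \<open>T n\<close> lies in \<open>S\<close>,
        so the parallelogram law bounds the square of their distance by
        \<open>4 / real (Suc n)\<close>, hence the threshold \<open>e\<^sup>2 / 4\<close>.\<close>
      obtain n where n: "1 / real (Suc n) < e\<^sup>2 / 4"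
        using nat_approx_posE[of "e\<^sup>2 / 4"] e by auto
      have "dist p q < e" if p: "p \<in> T n" and q: "q \<in> T n" for p q
      proof -
        have "(1/2) *\<^sub>R (p + q) \<in> S"
          using p q S by (auto simp: T_def intro!: subspace_scale subspace_add)
        from d_le[OF this] have "4 * d \<le> 4 * N ((1/2) *\<^sub>R (p + q))"
          by simp
        also have "\<dots> = (norm (2 *\<^sub>R (h - (1/2) *\<^sub>R (p + q))))\<^sup>2"
          by (simp add: N_def power_mult_distrib)
        also have "2 *\<^sub>R (h - (1/2) *\<^sub>R (p + q)) = (h - p) + (h - q)"
          by (simp add: scaleR_diff_right scaleR_2)
        finally have 1: "4 * d \<le> (norm ((h - p) + (h - q)))\<^sup>2" .
        have 2: "(norm ((h - p) - (h - q)))\<^sup>2 + (norm ((h - p) + (h - q)))\<^sup>2 = 2 * N p + 2 * N q"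
          by (simp only: N_def power2_norm_eq_inner) (simp add: inner_simps)
        have "(h - p) - (h - q) = - (p - q)"
          by simp
        then have "(norm ((h - p) - (h - q)))\<^sup>2 = (norm (p - q))\<^sup>2"
          by (simp only: norm_minus_cancel)
        with 1 2 have "(norm (p - q))\<^sup>2 \<le> 4 / real (Suc n)"
          using p q by (auto simp: T_def)
        also have "\<dots> < e\<^sup>2"
          using n by simp
        finally show ?thesis
          using e by (simp add: dist_norm power2_less_imp_less)
      qed
      then show ?thesis by blast
    qed
  qed blast
  have aS: "a \<in> S"
    using a[of 0] by (simp add: T_def)
  have Na: "N a \<le> d"
  proof (rule field_le_epsilon)
    fix e :: real
    assume "e > 0"
    then obtain n where "1 / real (Suc n) < e"
      using nat_approx_posE by blast
    then show "N a \<le> d + e"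
      using a[of n] by (simp add: T_def)
  qed
  have "inner (h - a) v = 0" if v: "v \<in> S" for v
  proof (cases "v = 0")
    case False
    \<comment> \<open>This \<open>t\<close> minimizes the quadratic
      \<open>N (a + t *\<^sub>R v)\<close>, which then drops below \<open>N a\<close> by
      \<open>t * t * inner v v\<close>. As \<open>a\<close> is already a minimizer, \<open>t\<close>
      must vanish.\<close>
    define t where "t = inner (h - a) v / inner v v"
    have "a + t *\<^sub>R v \<in> S"
      using S aS v by (auto intro: subspace_add subspace_scale)
    with d_le Na have "N a \<le> N (a + t *\<^sub>R v)"
      by (meson order_trans)
    also have "\<dots> = N a - 2 * t * inner (h - a) v + t * t * inner v v"
      by (simp add: N_def power2_norm_eq_inner inner_simps inner_commute algebra_simps)
    also have "\<dots> = N a - t * t * inner v v"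
      using False by (simp add: t_def)
    finally have "t * t * inner v v \<le> 0"
      by simp
    moreover have "inner v v > 0"
      using False by simp
    ultimately have "t * t \<le> 0"
      by (meson mult_le_0_iff not_less zero_le_square)
    then have "t = 0"
      by (metis antisym mult_eq_0_iff zero_le_square)
    then show ?thesis
      using False by (simp add: t_def)
  qed simp
  with aS that show ?thesis by blast
qed

text \<open>The kernel of a nonzero functional has codimension one, so a vector \<open>u\<close>
  orthogonal to it determines the functional up to scaling.\<close>

lemma riesz_representation:
  fixes f :: "'a::{real_inner, complete_space} \<Rightarrow> real"
  assumes "bounded_linear f"
  obtains v where "\<And>x. f x = inner x v"
proof (cases "\<forall>x. f x = 0")
  case True
  with that[of 0] show ?thesis by simp
next
  case False
  interpret f: bounded_linear f by (rule assms)
  define S where "S = {x. f x = 0}"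
  have S: "subspace S" "closed S"
    unfolding S_def subspace_def
    by (auto simp: f.zero f.add f.scaleR intro!: closed_Collect_eq f.continuous_on continuous_intros)
  obtain h where h: "f h \<noteq> 0"
    using False by blast
  obtain p where p: "p \<in> S" "\<And>v. v \<in> S \<Longrightarrow> inner (h - p) v = 0"
    using orthogonal_projection_exists[OF S] by blast
  define u where "u = h - p"
  have fu: "f u \<noteq> 0"
    using h p by (simp add: u_def f.diff S_def)
  then have u: "inner u u \<noteq> 0"
    by (auto simp: f.zero)
  have "f x = inner x ((f u / inner u u) *\<^sub>R u)" for x
  proof -
    have "x - (f x / f u) *\<^sub>R u \<in> S"
      using fu by (simp add: S_def f.diff f.scaleR)
    from p(2)[OF this] have "inner u x = f x / f u * inner u u"
      by (simp add: u_def[symmetric] inner_simps)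
    then show ?thesis
      using fu u by (simp add: inner_commute)
  qed
  with that show ?thesis by blast
qed

section \<open>Complex inner products, complements and adjoints\<close>

lemma cinner_scaleC_right: "cinner x (a *\<^sub>C y) = cnj a * cinner x y"
  by (subst (1 2) cinner_commute) (simp add: cinner_scaleC_left)

text \<open>Recovers the complex inner product from its real part, since multiplying the second
  argument by the imaginary unit exposes the imaginary part. Boundedness and orthogonality thus
  carry over from the real structure.\<close>

lemma cinner_eq_inner:
  "cinner x y = complex_of_real (inner x y) + \<i> * complex_of_real (inner x (\<i> *\<^sub>C y))"
  by (rule complex_eqI) (auto simp: inner_Re_cinner cinner_scaleC_right)

lemma bounded_linear_cinner_left: "bounded_linear (\<lambda>x. cinner x y)"
  unfolding cinner_eq_inner
  by (intro bounded_linear_add bounded_linear_const_mult bounded_linear_of_real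
      bounded_linear_compose[OF bounded_linear_of_real] bounded_linear_inner_left)

lemma bounded_linear_cinner_right: "bounded_linear (\<lambda>y. cinner x y)"
  by (subst cinner_commute)
    (intro bounded_linear_compose[OF bounded_linear_cnj] bounded_linear_cinner_left)

lemmas cinner_diff_left = linear_diff[OF bounded_linear.linear[OF bounded_linear_cinner_left]]
  and cinner_diff_right = linear_diff[OF bounded_linear.linear[OF bounded_linear_cinner_right]]

lemma cinner_self_eq_0_iff: "cinner x x = 0 \<longleftrightarrow> x = 0"
  using inner_Re_cinner[of x x] linear_0[OF bounded_linear.linear[OF bounded_linear_cinner_left]]
  by (metis inner_eq_zero_iff zero_complex.sel(1))

lemma cinner_eq_0_commute: "cinner x y = 0 \<longleftrightarrow> cinner y x = 0"
  by (metis cinner_commute complex_cnj_zero_iff)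

lemma cmod_cinner_commute: "cmod (cinner x y) = cmod (cinner y x)"
  by (metis cinner_commute complex_mod_cnj)

lemma norm_scaleC: "norm (a *\<^sub>C x) = cmod a * norm x"
proof -
  have "cinner (a *\<^sub>C x) (a *\<^sub>C x) = (a * cnj a) * cinner x x"
    by (simp add: cinner_scaleC_left cinner_scaleC_right mult_ac)
  also have "\<dots> = (cmod a)\<^sup>2 *\<^sub>R cinner x x"
    by (simp only: complex_norm_square[symmetric] scaleR_conv_of_real)
  finally have "(norm (a *\<^sub>C x))\<^sup>2 = (cmod a * norm x)\<^sup>2"
    by (simp add: power2_norm_eq_inner[where 'a = 'a] inner_Re_cinner power_mult_distrib)
  then show ?thesis
    by simp
qed

lemma bounded_linear_scaleC_right: "bounded_linear (\<lambda>x. a *\<^sub>C x)"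
  by (rule bounded_linear_intro[where K = "cmod a"])
    (simp_all add: scaleC_add_right scaleR_scaleC scaleC_scaleC norm_scaleC mult.commute)

lemma csubspace_iff:
  "csubspace X \<longleftrightarrow> 0 \<in> X \<and> (\<forall>x\<in>X. \<forall>y\<in>X. x + y \<in> X) \<and> (\<forall>c. \<forall>x\<in>X. c *\<^sub>C x \<in> X)"
  by (simp add: complex_vector.subspace_def)

lemma csubspace_imp_subspace: "csubspace X \<Longrightarrow> subspace X"
  by (auto simp: csubspace_iff subspace_def scaleR_scaleC)

lemma csubspace_orth_compl: "csubspace (orth_compl X)"
  using linear_0[OF bounded_linear.linear[OF bounded_linear_cinner_left]]
  by (auto simp: csubspace_iff orth_compl_def cinner_add_left cinner_scaleC_left)

text \<open>A complex subspace contains \<open>\<i> *\<^sub>C v\<close> along with \<open>v\<close>,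
  so real orthogonality to both already gives complex orthogonality.\<close>

lemma closed_csubspace_projection_exists:
  fixes X :: "'a::complex_hilbert_space set"
  assumes X: "closed_csubspace X"
  obtains p where "p \<in> X" "h - p \<in> orth_compl X"
proof -
  have "subspace X" "closed X"
    using X by (auto simp: closed_csubspace_def csubspace_imp_subspace)
  then obtain p where p: "p \<in> X" "\<And>v. v \<in> X \<Longrightarrow> inner (h - p) v = 0"
    using orthogonal_projection_exists by blast
  have "cinner (h - p) v = 0" if "v \<in> X" for v
  proof -
    have "\<i> *\<^sub>C v \<in> X"
      using X that by (auto simp: closed_csubspace_def csubspace_iff)
    then show ?thesis
      using p(2) that by (simp add: cinner_eq_inner)
  qed
  then show ?thesis
    using p(1) that by (auto simp: orth_compl_def)
qed

text \<open>For \<open>x\<close> in the double complement with projection \<open>p\<close>, the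
  difference \<open>x - p\<close> is orthogonal to both \<open>x\<close> and \<open>p\<close>, hence
  to itself. In (i) this turns orthogonality to \<open>orth_compl V\<close> into membership in
  \<open>V\<close>.\<close>

lemma orth_compl_orth_compl:
  fixes X :: "'a::complex_hilbert_space set"
  assumes X: "closed_csubspace X"
  shows "orth_compl (orth_compl X) = X"
proof
  show "X \<subseteq> orth_compl (orth_compl X)"
    by (auto simp: orth_compl_def cinner_eq_0_commute)
  show "orth_compl (orth_compl X) \<subseteq> X"
  proof
    fix x
    assume x: "x \<in> orth_compl (orth_compl X)"
    obtain p where p: "p \<in> X" "x - p \<in> orth_compl X"
      using closed_csubspace_projection_exists[OF X] .
    have "cinner x (x - p) = 0"
      using x p by (auto simp: orth_compl_def)
    moreover have "cinner p (x - p) = 0"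
      using p cinner_commute[of p "x - p"] by (simp add: orth_compl_def)
    ultimately have "cinner (x - p) (x - p) = 0"
      using cinner_diff_left[of x p "x - p"] by simp
    then show "x \<in> X"
      using p by (simp add: cinner_self_eq_0_iff)
  qed
qed

text \<open>\<open>bounded_linear\<close> only speaks of real scalars; complex homogeneity is added
  so that the operator has an adjoint for \<open>cinner\<close>.\<close>

definition bounded_clinear :: "('a::complex_inner \<Rightarrow> 'b::complex_inner) \<Rightarrow> bool"
  where "bounded_clinear L \<longleftrightarrow> bounded_linear L \<and> (\<forall>a x. L (a *\<^sub>C x) = a *\<^sub>C L x)"

lemma bounded_clinear_compose:
  "bounded_clinear L \<Longrightarrow> bounded_clinear L' \<Longrightarrow> bounded_clinear (\<lambda>x. L (L' x))"
  by (simp add: bounded_clinear_def bounded_linear_compose)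

text \<open>Justifies the choice in \<open>cadjoint\<close>. Riesz is applied to the real part of
  \<open>cinner (L x) y\<close>; the imaginary part follows by evaluating at
  \<open>\<i> *\<^sub>C x\<close>.\<close>

lemma cinner_cadjoint:
  fixes L :: "'a::complex_hilbert_space \<Rightarrow> 'b::complex_inner"
  assumes L: "bounded_clinear L"
  shows "cinner (L x) y = cinner x (cadjoint L y)"
proof -
  have "\<exists>v. \<forall>x. cinner (L x) y = cinner x v" for y
  proof -
    have "bounded_linear (\<lambda>x. inner (L x) y)"
      using L by (intro bounded_linear_compose[OF bounded_linear_inner_left])
        (simp add: bounded_clinear_def)
    then obtain v where v: "\<And>x. inner (L x) y = inner x v"
      using riesz_representation by blast
    have "cinner (L x) y = cinner x v" for x
    proof (rule complex_eqI)
      show "Re (cinner (L x) y) = Re (cinner x v)"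
        using v by (simp add: inner_Re_cinner)
      have "inner (L (\<i> *\<^sub>C x)) y = inner (\<i> *\<^sub>C x) v"
        by (rule v)
      then show "Im (cinner (L x) y) = Im (cinner x v)"
        using L by (simp add: bounded_clinear_def inner_Re_cinner cinner_scaleC_left)
    qed
    then show ?thesis by blast
  qed
  then have "\<exists>L'. \<forall>x y. cinner (L x) y = cinner x (L' y)"
    by metis
  from someI_ex[OF this] show ?thesis
    unfolding cadjoint_def by blast
qed

section \<open>Bessel sequences and multipliers\<close>

lemma bessel_seq_onE:
  assumes "bessel_seq_on X f"
  obtains B where "B > 0" and "range f \<subseteq> X"
    and "\<And>h. h \<in> X \<Longrightarrow> summable (\<lambda>n. (cmod (cinner h (f n)))\<^sup>2)"
    and "\<And>h. h \<in> X \<Longrightarrow> (\<Sum>n. (cmod (cinner h (f n)))\<^sup>2) \<le> B * (norm h)\<^sup>2"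
  using assms unfolding bessel_seq_on_def by metis

text \<open>Duality between synthesis and analysis: expand \<open>cinner s s\<close> for the finite
  sum \<open>s\<close>, apply Cauchy-Schwarz to the coefficients, bound the analysis coefficients of
  \<open>s\<close> by the Bessel inequality, and cancel one factor \<open>norm s\<close>.\<close>

lemma bessel_seq_finite_synthesis_bound:
  fixes f :: "nat \<Rightarrow> 'a::complex_inner"
  assumes "bessel_seq_on UNIV f"
  obtains B where "B > 0"
    and "\<And>c I. finite I \<Longrightarrow> (norm (\<Sum>n\<in>I. c n *\<^sub>C f n))\<^sup>2 \<le> B * (\<Sum>n\<in>I. (cmod (c n))\<^sup>2)"
proof -
  obtain B where B: "B > 0" and summ: "\<And>h. summable (\<lambda>n. (cmod (cinner h (f n)))\<^sup>2)"
    and le: "\<And>h. (\<Sum>n. (cmod (cinner h (f n)))\<^sup>2) \<le> B * (norm h)\<^sup>2"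
    by (rule bessel_seq_onE[OF assms]) simp
  have "(norm (\<Sum>n\<in>I. c n *\<^sub>C f n))\<^sup>2 \<le> B * (\<Sum>n\<in>I. (cmod (c n))\<^sup>2)" if I: "finite I" for c I
  proof -
    define s where "s = (\<Sum>n\<in>I. c n *\<^sub>C f n)"
    define a where "a = L2_set (\<lambda>n. cmod (c n)) I"
    define b where "b = L2_set (\<lambda>n. cmod (cinner s (f n))) I"
    have "(\<Sum>n\<in>I. (cmod (cinner s (f n)))\<^sup>2) \<le> B * (norm s)\<^sup>2"
      by (rule order_trans[OF sum_le_suminf[OF summ I] le]) simp
    then have "b \<le> sqrt (B * (norm s)\<^sup>2)"
      unfolding b_def L2_set_def by (rule real_sqrt_le_mono)
    then have b: "b \<le> sqrt B * norm s"
      by (simp add: real_sqrt_mult)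
    have "(norm s)\<^sup>2 = Re (cinner s s)"
      by (simp add: power2_norm_eq_inner inner_Re_cinner)
    also have "cinner s s = (\<Sum>n\<in>I. c n * cinner (f n) s)"
      using linear_sum[OF bounded_linear.linear[OF bounded_linear_cinner_left],
          of "\<lambda>n. c n *\<^sub>C f n" I s]
      by (simp add: s_def[symmetric] cinner_scaleC_left)
    also have "Re \<dots> \<le> cmod \<dots>"
      by (rule complex_Re_le_cmod)
    also have "\<dots> \<le> (\<Sum>n\<in>I. cmod (c n) * cmod (cinner s (f n)))"
      using norm_sum[of "\<lambda>n. c n * cinner (f n) s" I]
      by (simp add: norm_mult cmod_cinner_commute[of s])
    also have "\<dots> \<le> a * b"
      unfolding a_def b_def
      using L2_set_mult_ineq[of "\<lambda>n. cmod (c n)" "\<lambda>n. cmod (cinner s (f n))" I] by simp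
    also have "\<dots> \<le> a * (sqrt B * norm s)"
      using b by (intro mult_left_mono) (simp_all add: a_def)
    finally have "norm s * norm s \<le> (a * sqrt B) * norm s"
      by (simp add: power2_eq_square mult.assoc)
    then have "norm s \<le> a * sqrt B"
      using B by (cases "s = 0") (auto simp: a_def)
    then have "(norm s)\<^sup>2 \<le> (a * sqrt B)\<^sup>2"
      by (rule power_mono) simp
    also have "\<dots> = B * (\<Sum>n\<in>I. (cmod (c n))\<^sup>2)"
      using B by (simp add: a_def L2_set_def power_mult_distrib sum_nonneg)
    finally show ?thesis
      by (simp add: s_def)
  qed
  with B that show ?thesis by blast
qed

text \<open>The finite bound on blocks of indices makes the partial sums Cauchy, and its limit
  bounds the full series.\<close>

lemma bessel_seq_synthesis:
  fixes f :: "nat \<Rightarrow> 'a::complex_hilbert_space"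
  assumes "bessel_seq_on UNIV f"
  obtains B where "B > 0"
    and "\<And>c. summable (\<lambda>n. (cmod (c n))\<^sup>2) \<Longrightarrow> summable (\<lambda>n. c n *\<^sub>C f n)"
    and "\<And>c. summable (\<lambda>n. (cmod (c n))\<^sup>2) \<Longrightarrow>
      (norm (\<Sum>n. c n *\<^sub>C f n))\<^sup>2 \<le> B * (\<Sum>n. (cmod (c n))\<^sup>2)"
proof -
  obtain B where B: "B > 0"
    and le: "\<And>c I. finite I \<Longrightarrow> (norm (\<Sum>n\<in>I. c n *\<^sub>C f n))\<^sup>2 \<le> B * (\<Sum>n\<in>I. (cmod (c n))\<^sup>2)"
    using bessel_seq_finite_synthesis_bound[OF assms] by metis
  have summ: "summable (\<lambda>n. c n *\<^sub>C f n)" if c: "summable (\<lambda>n. (cmod (c n))\<^sup>2)" for c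
    unfolding summable_Cauchy
  proof (intro allI impI)
    fix e :: real
    assume e: "e > 0"
    then have "e\<^sup>2 / B > 0"
      using B by simp
    then obtain N where N: "\<And>m n. m \<ge> N \<Longrightarrow> norm (\<Sum>n\<in>{m..<n}. (cmod (c n))\<^sup>2) < e\<^sup>2 / B"
      using c unfolding summable_Cauchy by blast
    have "norm (\<Sum>n\<in>{m..<n}. c n *\<^sub>C f n) < e" if "m \<ge> N" for m n
    proof -
      have "(norm (\<Sum>n\<in>{m..<n}. c n *\<^sub>C f n))\<^sup>2 \<le> B * (\<Sum>n\<in>{m..<n}. (cmod (c n))\<^sup>2)"
        by (intro le) simp
      also have "\<dots> < B * (e\<^sup>2 / B)"
        using N[OF that, of n] B by (intro mult_strict_left_mono) (auto simp: sum_nonneg)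
      finally show ?thesis
        using B e by (simp add: power2_less_imp_less)
    qed
    then show "\<exists>N. \<forall>m\<ge>N. \<forall>n. norm (\<Sum>n\<in>{m..<n}. c n *\<^sub>C f n) < e"
      by blast
  qed
  moreover have "(norm (\<Sum>n. c n *\<^sub>C f n))\<^sup>2 \<le> B * (\<Sum>n. (cmod (c n))\<^sup>2)"
    if c: "summable (\<lambda>n. (cmod (c n))\<^sup>2)" for c
  proof (rule LIMSEQ_le)
    show "(\<lambda>N. (norm (\<Sum>n<N. c n *\<^sub>C f n))\<^sup>2) \<longlonglongrightarrow> (norm (\<Sum>n. c n *\<^sub>C f n))\<^sup>2"
      by (intro tendsto_intros summable_LIMSEQ summ c)
    show "(\<lambda>N. B * (\<Sum>n<N. (cmod (c n))\<^sup>2)) \<longlonglongrightarrow> B * (\<Sum>n. (cmod (c n))\<^sup>2)"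
      by (intro tendsto_intros summable_LIMSEQ c)
  qed (auto intro: le)
  ultimately show ?thesis
    by (rule that[OF B])
qed

text \<open>The coefficients of \<open>h\<close> equal those of its orthogonal projection onto
  \<open>X\<close>, which is no longer than \<open>h\<close>. In (i) this makes the coefficients of
  an arbitrary \<open>h\<close> against a dual frame of \<open>orth_compl V\<close>
  square-summable.\<close>

lemma bessel_seq_on_UNIV:
  fixes f :: "nat \<Rightarrow> 'a::complex_hilbert_space"
  assumes f: "bessel_seq_on X f" and X: "closed_csubspace X"
  shows "bessel_seq_on UNIV f"
proof -
  obtain B where B: "B > 0" and fX: "range f \<subseteq> X"
    and summ: "\<And>h. h \<in> X \<Longrightarrow> summable (\<lambda>n. (cmod (cinner h (f n)))\<^sup>2)"
    and le: "\<And>h. h \<in> X \<Longrightarrow> (\<Sum>n. (cmod (cinner h (f n)))\<^sup>2) \<le> B * (norm h)\<^sup>2"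
    using f by (rule bessel_seq_onE) blast
  have "summable (\<lambda>n. (cmod (cinner h (f n)))\<^sup>2) \<and>
      (\<Sum>n. (cmod (cinner h (f n)))\<^sup>2) \<le> B * (norm h)\<^sup>2" for h
  proof -
    obtain p where p: "p \<in> X" "h - p \<in> orth_compl X"
      using closed_csubspace_projection_exists[OF X] .
    have eq: "cinner h (f n) = cinner p (f n)" for n
    proof -
      have "cinner (h - p) (f n) = 0"
        using p fX by (auto simp: orth_compl_def)
      then show ?thesis
        by (simp add: cinner_diff_left)
    qed
    have "inner (h - p) p = 0"
      using p by (simp add: orth_compl_def inner_Re_cinner)
    then have "inner h h = inner p p + inner (h - p) (h - p)"
      by (simp add: inner_simps inner_commute)
    then have "(norm p)\<^sup>2 \<le> (norm h)\<^sup>2"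
      by (simp add: power2_norm_eq_inner)
    then have "B * (norm p)\<^sup>2 \<le> B * (norm h)\<^sup>2"
      using B by simp
    then show ?thesis
      using summ[OF p(1)] le[OF p(1)] unfolding eq by simp
  qed
  then show ?thesis
    unfolding bessel_seq_on_def using B by blast
qed

lemma bessel_seq_on_summable:
  "bessel_seq_on X f \<Longrightarrow> h \<in> X \<Longrightarrow> summable (\<lambda>n. (cmod (cinner h (f n)))\<^sup>2)"
  unfolding bessel_seq_on_def by blast

lemma multiplier_bounded_clinear:
  fixes \<psi> :: "nat \<Rightarrow> 'a::complex_hilbert_space" and \<phi> :: "nat \<Rightarrow> 'b::complex_hilbert_space"
  assumes \<psi>: "bessel_seq_on UNIV \<psi>" and \<phi>: "bessel_seq_on UNIV \<phi>"
    and m: "bdd_above (range (\<lambda>n. cmod (m n)))"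
  shows "bounded_clinear (multiplier m \<phi> \<psi>)"
    and "summable (\<lambda>n. m n *\<^sub>C cinner h (\<psi> n) *\<^sub>C \<phi> n)"
proof -
  obtain K where K: "\<And>n. cmod (m n) \<le> K"
    using m by (auto simp: bdd_above_def)
  obtain B where B: "B > 0"
    and summ: "\<And>c. summable (\<lambda>n. (cmod (c n))\<^sup>2) \<Longrightarrow> summable (\<lambda>n. c n *\<^sub>C \<phi> n)"
    and le: "\<And>c. summable (\<lambda>n. (cmod (c n))\<^sup>2) \<Longrightarrow>
      (norm (\<Sum>n. c n *\<^sub>C \<phi> n))\<^sup>2 \<le> B * (\<Sum>n. (cmod (c n))\<^sup>2)"
    by (rule bessel_seq_synthesis[OF \<phi>]) blast
  obtain B' where B': "B' > 0"
    and summ': "\<And>h. summable (\<lambda>n. (cmod (cinner h (\<psi> n)))\<^sup>2)"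
    and le': "\<And>h. (\<Sum>n. (cmod (cinner h (\<psi> n)))\<^sup>2) \<le> B' * (norm h)\<^sup>2"
    by (rule bessel_seq_onE[OF \<psi>]) simp
  have mc_le: "(cmod (m n * cinner h (\<psi> n)))\<^sup>2 \<le> K\<^sup>2 * (cmod (cinner h (\<psi> n)))\<^sup>2" for h n
    using power_mono[OF K[of n] norm_ge_zero, of 2]
    by (simp add: norm_mult power_mult_distrib mult_right_mono)
  have mc: "summable (\<lambda>n. (cmod (m n * cinner h (\<psi> n)))\<^sup>2)" for h
    by (rule summable_comparison_test'[OF summable_mult[OF summ', of "K\<^sup>2"], of 0])
      (use mc_le in auto)
  have eq: "multiplier m \<phi> \<psi> = (\<lambda>h. \<Sum>n. (m n * cinner h (\<psi> n)) *\<^sub>C \<phi> n)"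
    by (simp add: multiplier_def scaleC_scaleC fun_eq_iff)
  have s: "summable (\<lambda>n. (m n * cinner h (\<psi> n)) *\<^sub>C \<phi> n)" for h
    by (rule summ[OF mc])
  then show "summable (\<lambda>n. m n *\<^sub>C cinner h (\<psi> n) *\<^sub>C \<phi> n)"
    by (simp add: scaleC_scaleC)
  \<comment> \<open>\<open>B\<close> bounds synthesis by \<open>\<phi>\<close>, \<open>K\<close>
    bounds the weights, and \<open>B'\<close> bounds analysis by \<open>\<psi>\<close>.\<close>
  define L where "L = sqrt (B * (K\<^sup>2 * B'))"
  have bound: "norm (multiplier m \<phi> \<psi> h) \<le> L * norm h" for h
  proof -
    have "(\<Sum>n. (cmod (m n * cinner h (\<psi> n)))\<^sup>2) \<le> (\<Sum>n. K\<^sup>2 * (cmod (cinner h (\<psi> n)))\<^sup>2)"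
      by (intro suminf_le mc_le mc summable_mult summ')
    also have "\<dots> = K\<^sup>2 * (\<Sum>n. (cmod (cinner h (\<psi> n)))\<^sup>2)"
      by (rule suminf_mult[OF summ'])
    also have "\<dots> \<le> K\<^sup>2 * (B' * (norm h)\<^sup>2)"
      by (intro mult_left_mono le') simp
    finally have "B * (\<Sum>n. (cmod (m n * cinner h (\<psi> n)))\<^sup>2) \<le> B * (K\<^sup>2 * (B' * (norm h)\<^sup>2))"
      using B by (intro mult_left_mono) auto
    with le[OF mc, of h] have "(norm (multiplier m \<phi> \<psi> h))\<^sup>2 \<le> B * (K\<^sup>2 * (B' * (norm h)\<^sup>2))"
      by (simp add: eq)
    also have "\<dots> = (L * norm h)\<^sup>2"
      using B B' by (simp add: L_def power_mult_distrib)
    finally show ?thesis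
      by (rule power2_le_imp_le) (use B B' in \<open>simp add: L_def\<close>)
  qed
  have scale: "multiplier m \<phi> \<psi> (a *\<^sub>C h) = a *\<^sub>C multiplier m \<phi> \<psi> h" for a h
  proof -
    from bounded_linear.suminf[OF bounded_linear_scaleC_right s, of a h] show ?thesis
      by (simp add: eq scaleC_scaleC cinner_scaleC_left mult_ac)
  qed
  have "bounded_linear (multiplier m \<phi> \<psi>)"
  proof (rule bounded_linear_intro)
    show "multiplier m \<phi> \<psi> (x + y) = multiplier m \<phi> \<psi> x + multiplier m \<phi> \<psi> y" for x y
      by (simp add: eq suminf_add s cinner_add_left scaleC_add_left algebra_simps)
    show "multiplier m \<phi> \<psi> (r *\<^sub>R x) = r *\<^sub>R multiplier m \<phi> \<psi> x" for r x
      by (simp add: scaleR_scaleC scale)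
    show "norm (multiplier m \<phi> \<psi> x) \<le> norm x * L" for x
      using bound[of x] by (simp add: mult.commute)
  qed
  then show "bounded_clinear (multiplier m \<phi> \<psi>)"
    by (simp add: bounded_clinear_def scale)
qed

section \<open>The oblique pseudoinverse\<close>

lemma is_direct_sum_eq_0: "is_direct_sum X Z \<Longrightarrow> x \<in> X \<Longrightarrow> x \<in> Z \<Longrightarrow> x = 0"
  by (auto simp: is_direct_sum_def)

lemma oblique_proj_eq:
  assumes X: "csubspace X" and Z: "csubspace Z" and XZ: "is_direct_sum X Z"
    and x: "x \<in> X" and z: "z \<in> Z"
  shows "oblique_proj X Z (x + z) = x"
  unfolding oblique_proj_def
proof (rule the_equality)
  fix x'
  assume x': "x' \<in> X \<and> (\<exists>z'\<in>Z. x + z = x' + z')"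
  then obtain z' where z': "z' \<in> Z" "x + z = x' + z'"
    by blast
  have "x' - x = z - z'"
    using z' by (simp add: algebra_simps)
  moreover have "x' - x \<in> X" "z - z' \<in> Z"
    using X Z x x' z z' by (auto intro: complex_vector.subspace_diff)
  ultimately show "x' = x"
    using is_direct_sum_eq_0[OF XZ, of "x' - x"] by simp
qed (use x z in blast)

lemma oblique_proj_diff_mem:
  assumes X: "csubspace X" and Z: "csubspace Z" and XZ: "is_direct_sum X Z"
  shows "h - oblique_proj X Z h \<in> Z"
proof -
  obtain x z where xz: "x \<in> X" "z \<in> Z" "h = x + z"
    using XZ unfolding is_direct_sum_def by blast
  then show ?thesis
    using oblique_proj_eq[OF assms xz(1,2)] by simp
qed

text \<open>Two candidates \<open>x\<close> and \<open>x'\<close> have images differing by an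
  element of both \<open>range M\<close> and \<open>V\<close>, so \<open>x' - x\<close> lies in
  \<open>ker M\<close>, and also in \<open>W\<close>.\<close>

lemma oblique_pinv_eq:
  assumes M: "bounded_clinear M" and W: "csubspace W" and V: "csubspace V"
    and WM: "is_direct_sum W (ker M)" and MV: "is_direct_sum (range M) V"
    and x: "x \<in> W" and z: "z \<in> V"
  shows "oblique_pinv W V M (M x + z) = x"
  unfolding oblique_pinv_def
proof (rule the_equality)
  interpret M: bounded_linear M
    using M by (simp add: bounded_clinear_def)
  fix x'
  assume x': "x' \<in> W \<and> (\<exists>z'\<in>V. M x + z = M x' + z')"
  then obtain z' where z': "z' \<in> V" "M x + z = M x' + z'"
    by blast
  have "M (x' - x) = z - z'"
    using z' by (simp add: algebra_simps M.diff)
  moreover have "z - z' \<in> V"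
    using V z z' by (auto intro: complex_vector.subspace_diff)
  ultimately have "M (x' - x) = 0"
    using is_direct_sum_eq_0[OF MV rangeI, of "x' - x"] by simp
  then have "x' - x \<in> ker M"
    by (simp add: ker_def)
  moreover have "x' - x \<in> W"
    using W x x' by (auto intro: complex_vector.subspace_diff)
  ultimately show "x' = x"
    using is_direct_sum_eq_0[OF WM, of "x' - x"] by simp
qed (use x z in blast)

lemma oblique_decomposition:
  assumes M: "bounded_clinear M"
    and WM: "is_direct_sum W (ker M)" and MV: "is_direct_sum (range M) V"
  obtains x z where "x \<in> W" "z \<in> V" "y = M x + z"
proof -
  interpret M: bounded_linear M
    using M by (simp add: bounded_clinear_def)
  obtain u z where u: "z \<in> V" "y = M u + z"
    using MV unfolding is_direct_sum_def by blast
  obtain x k where "x \<in> W" "k \<in> ker M" "u = x + k"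
    using WM unfolding is_direct_sum_def by blast
  then show ?thesis
    using u that by (simp add: M.add ker_def)
qed

lemma oblique_pinv_bounded_clinear:
  fixes M :: "'a::complex_hilbert_space \<Rightarrow> 'b::complex_hilbert_space"
  assumes M: "bounded_clinear M" and W: "closed_csubspace W" and V: "closed_csubspace V"
    and WM: "is_direct_sum W (ker M)" and MV: "is_direct_sum (range M) V"
  shows "bounded_clinear (oblique_pinv W V M)"
proof -
  interpret M: bounded_linear M
    using M by (simp add: bounded_clinear_def)
  have W': "csubspace W" "closed W" and V': "csubspace V" "closed V"
    using W V by (auto simp: closed_csubspace_def)
  note eq = oblique_pinv_eq[OF M W'(1) V'(1) WM MV]
  note dec = oblique_decomposition[OF M WM MV]
  \<comment> \<open>Working on the closed subspace \<open>W \<times> V\<close> gives a preimage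
    \<open>(x, z)\<close> of \<open>y\<close> with controlled norm; its first component is the
    pseudoinverse value.\<close>
  define f where "f = (\<lambda>p. M (fst p) + snd p)"
  have f: "bounded_linear f"
    unfolding f_def
    by (intro bounded_linear_add bounded_linear_compose[OF M.bounded_linear_axioms]
        bounded_linear_fst bounded_linear_snd)
  have "subspace (W \<times> V)" "closed (W \<times> V)"
    using W' V' by (auto intro: subspace_Times csubspace_imp_subspace closed_Times)
  moreover have "f ` (W \<times> V) = UNIV"
  proof -
    have "y \<in> f ` (W \<times> V)" for y
    proof -
      obtain x z where "x \<in> W" "z \<in> V" "y = M x + z"
        using dec .
      then show ?thesis
        by (auto simp: f_def image_iff intro!: bexI[of _ "(x, z)"])
    qed
    then show ?thesis by blast
  qed
  ultimately obtain C where C: "\<And>y. \<exists>p\<in>W \<times> V. f p = y \<and> norm p \<le> C * norm y"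
    using surj_on_closed_subspace_bounded_preimage[OF f] by metis
  have "bounded_linear (oblique_pinv W V M)"
  proof (rule bounded_linear_intro)
    fix y y'
    obtain x z where xz: "x \<in> W" "z \<in> V" "y = M x + z"
      using dec .
    obtain x' z' where xz': "x' \<in> W" "z' \<in> V" "y' = M x' + z'"
      using dec .
    have "y + y' = M (x + x') + (z + z')"
      by (simp add: xz xz' M.add)
    moreover have "x + x' \<in> W" "z + z' \<in> V"
      using xz xz' W' V' by (auto simp: csubspace_iff)
    ultimately show "oblique_pinv W V M (y + y') = oblique_pinv W V M y + oblique_pinv W V M y'"
      using eq[of "x + x'" "z + z'"] eq[of x z] eq[of x' z'] xz xz' by metis
  next
    fix r y
    obtain x z where xz: "x \<in> W" "z \<in> V" "y = M x + z"
      using dec .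
    have "r *\<^sub>R y = M (r *\<^sub>R x) + r *\<^sub>R z"
      by (simp add: xz M.scaleR scaleR_add_right)
    moreover have "r *\<^sub>R x \<in> W" "r *\<^sub>R z \<in> V"
      using xz W' V' by (auto simp: csubspace_iff scaleR_scaleC)
    ultimately show "oblique_pinv W V M (r *\<^sub>R y) = r *\<^sub>R oblique_pinv W V M y"
      using xz by (simp add: eq)
  next
    fix y
    obtain x z where xz: "x \<in> W" "z \<in> V" "M x + z = y" "norm (x, z) \<le> C * norm y"
      using C[of y] by (auto simp: f_def)
    then have "norm x \<le> C * norm y"
      using norm_fst_le[of x z] by linarith
    then show "norm (oblique_pinv W V M y) \<le> norm y * C"
      using eq[OF xz(1,2)] xz(3) by (simp add: mult.commute)
  qed
  moreover have "oblique_pinv W V M (a *\<^sub>C y) = a *\<^sub>C oblique_pinv W V M y" for a y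
  proof -
    obtain x z where xz: "x \<in> W" "z \<in> V" "y = M x + z"
      using dec .
    have "a *\<^sub>C y = M (a *\<^sub>C x) + a *\<^sub>C z"
      using M by (simp add: xz bounded_clinear_def scaleC_add_right)
    moreover have "a *\<^sub>C x \<in> W" "a *\<^sub>C z \<in> V"
      using xz W' V' by (auto simp: csubspace_iff)
    ultimately show ?thesis
      using xz by (simp add: eq)
  qed
  ultimately show ?thesis
    by (simp add: bounded_clinear_def)
qed

text \<open>Exhibits the oblique projection as a composition of bounded operators, so that its
  adjoint, which occurs in (ii), is meaningful.\<close>

lemma oblique_proj_eq_oblique_pinv:
  assumes M: "bounded_clinear M" and W: "csubspace W" and V: "csubspace V"
    and WM: "is_direct_sum W (ker M)" and MV: "is_direct_sum (range M) V"
  shows "oblique_proj W (ker M) = (\<lambda>x. oblique_pinv W V M (M x))"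
proof
  interpret M: bounded_linear M
    using M by (simp add: bounded_clinear_def)
  fix h
  obtain x k where xk: "x \<in> W" "k \<in> ker M" "h = x + k"
    using WM unfolding is_direct_sum_def by blast
  have "csubspace (ker M)"
    using M linear_0[OF M.linear_axioms]
    by (auto simp: csubspace_iff ker_def M.add bounded_clinear_def)
  then have "oblique_proj W (ker M) h = x"
    using xk W WM by (simp add: oblique_proj_eq)
  moreover have "oblique_pinv W V M (M h) = x"
    using oblique_pinv_eq[OF M W V WM MV xk(1), of 0] xk V
    by (simp add: ker_def M.add csubspace_iff)
  ultimately show "oblique_proj W (ker M) h = oblique_pinv W V M (M h)"
    by simp
qed

section \<open>The three multiplier representations\<close>

theorem theorem5p4:
  fixes \<Psi> :: "nat \<Rightarrow> 'a::complex_hilbert_space"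
    and \<Phi> :: "nat \<Rightarrow> 'b::complex_hilbert_space"
    and m :: "nat \<Rightarrow> complex"
    and M :: "'a \<Rightarrow> 'b" and M_sharp :: "'b \<Rightarrow> 'a"
    and W :: "'a set" and V :: "'b set"
    and \<Psi>_sharp :: "nat \<Rightarrow> 'a" and \<Phi>_sharp :: "nat \<Rightarrow> 'b"
  assumes "separable_space (euclidean :: 'a topology)"
    and "separable_space (euclidean :: 'b topology)"
    and "bessel_seq_on UNIV \<Psi>"
    and "bessel_seq_on UNIV \<Phi>"
    and "semi_normalized m"
    and M: "M = multiplier m \<Phi> \<Psi>"
    and "closed (range M)"
    and "closed_csubspace W"
    and "closed_csubspace V"
    and "is_direct_sum W (ker M)"
    and "is_direct_sum (range M) V"
    and M_sharp: "M_sharp = oblique_pinv W V M"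
    and \<Psi>_sharp: "\<Psi>_sharp = (\<lambda>n. M_sharp (m n *\<^sub>C \<Phi> n))"
    and \<Phi>_sharp: "\<Phi>_sharp = (\<lambda>n. cadjoint M_sharp (cnj (m n) *\<^sub>C \<Psi> n))"
  shows "(\<forall>\<Phi>_od. oblique_dual_frame (orth_compl V) (range M)
                   \<Phi>_od (\<lambda>n. oblique_proj (range M) V (\<Phi> n)) \<longrightarrow>
                 M_sharp = multiplier (\<lambda>n. 1 / m n) \<Psi>_sharp \<Phi>_od) \<and>
         (\<forall>\<Psi>_od. oblique_dual_frame W (orth_compl (ker M))
                   \<Psi>_od (\<lambda>n. cadjoint (oblique_proj W (ker M)) (\<Psi> n)) \<longrightarrow>
                 M_sharp = multiplier (\<lambda>n. 1 / m n) \<Psi>_od \<Phi>_sharp) \<and>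
         M_sharp = multiplier (\<lambda>n. 1 / m n) \<Psi>_sharp \<Phi>_sharp"
proof (intro conjI allI impI)
  have W: "csubspace W" and V: "csubspace V"
    using assms by (auto simp: closed_csubspace_def)
  have "0 < (INF n. cmod (m n))" and bdd: "bdd_above (range (\<lambda>n. cmod (m n)))"
    using assms by (auto simp: semi_normalized_def)
  moreover have "(INF n. cmod (m n)) \<le> cmod (m n)" for n
    by (intro cINF_lower bdd_belowI2[of _ 0]) auto
  ultimately have m_nz: "m n \<noteq> 0" for n
    by (metis norm_zero not_less)
  have clin_M: "bounded_clinear M"
    using multiplier_bounded_clinear(1)[OF assms(3,4) bdd] M by simp
  have M_summable: "summable (\<lambda>n. m n *\<^sub>C cinner h (\<Psi> n) *\<^sub>C \<Phi> n)" for h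
    by (rule multiplier_bounded_clinear(2)[OF assms(3,4) bdd])
  have clin_S: "bounded_clinear M_sharp"
    unfolding M_sharp using oblique_pinv_bounded_clinear clin_M assms by blast
  interpret S: bounded_linear M_sharp
    using clin_S by (simp add: bounded_clinear_def)
  have S_scale: "M_sharp (a *\<^sub>C y) = a *\<^sub>C M_sharp y" for a y
    using clin_S by (simp add: bounded_clinear_def)
  note pinv_eq = oblique_pinv_eq[OF clin_M W V assms(10,11), folded M_sharp]
  note dec = oblique_decomposition[OF clin_M assms(10,11)]
  have M_0: "M 0 = 0"
    using clin_M by (simp add: bounded_clinear_def linear_simps)
  have S_W: "M_sharp y \<in> W" for y
    using dec[of y] pinv_eq by metis
  have S_V: "M_sharp z = 0" if "z \<in> V" for z
    using pinv_eq[of 0 z] that W M_0 by (simp add: csubspace_iff)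
  have SMS: "M_sharp (M (M_sharp y)) = M_sharp y" for y
    using pinv_eq[of "M_sharp y" 0] S_W V by (simp add: csubspace_iff)
  \<comment> \<open>The adjoint moves \<open>M_sharp\<close> onto \<open>h\<close>, and conjugate
    linearity in the second slot turns \<open>cnj (m n)\<close> into \<open>m n\<close>.\<close>
  have \<Phi>_sharp_inner: "cinner h (\<Phi>_sharp n) = m n * cinner (M_sharp h) (\<Psi> n)" for h n
    by (simp add: \<Phi>_sharp cinner_cadjoint[OF clin_S, symmetric] cinner_scaleC_right)

  show "M_sharp = multiplier (\<lambda>n. 1 / m n) \<Psi>_sharp \<Phi>_sharp"
  proof
    fix h
    note MS_summable = M_summable[of "M_sharp h"]
    \<comment> \<open>Each sharp sequence contributes one factor \<open>m n\<close>;
      \<open>1 / m n\<close> cancels one of them, and the other rebuilds the series of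
      \<open>M\<close>.\<close>
    have "multiplier (\<lambda>n. 1 / m n) \<Psi>_sharp \<Phi>_sharp h
        = (\<Sum>n. M_sharp (m n *\<^sub>C cinner (M_sharp h) (\<Psi> n) *\<^sub>C \<Phi> n))"
      using m_nz
      by (simp add: multiplier_def \<Phi>_sharp_inner \<Psi>_sharp S_scale scaleC_scaleC mult_ac)
    also have "\<dots> = M_sharp (M (M_sharp h))"
      by (simp only: S.suminf[OF MS_summable, symmetric] M multiplier_def)
    finally show "M_sharp h = multiplier (\<lambda>n. 1 / m n) \<Psi>_sharp \<Phi>_sharp h"
      by (simp add: SMS)
  qed

  show "M_sharp = multiplier (\<lambda>n. 1 / m n) \<Psi>_od \<Phi>_sharp"
    if od: "oblique_dual_frame W (orth_compl (ker M)) \<Psi>_od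
      (\<lambda>n. cadjoint (oblique_proj W (ker M)) (\<Psi> n))" for \<Psi>_od
  proof
    fix h
    let ?K = "orth_compl (orth_compl (ker M))"
    have proj: "oblique_proj W (ker M) = (\<lambda>x. M_sharp (M x))"
      using oblique_proj_eq_oblique_pinv[OF clin_M W V assms(10,11)] M_sharp by simp
    have clin_P: "bounded_clinear (oblique_proj W (ker M))"
      unfolding proj by (rule bounded_clinear_compose[OF clin_S clin_M])
    \<comment> \<open>Moved to the left slot, the projection fixes \<open>M_sharp h\<close>, so the
      analysis coefficients are those of \<open>\<Psi>\<close> itself.\<close>
    have "cinner (M_sharp h) (cadjoint (oblique_proj W (ker M)) (\<Psi> n))
        = cinner (M_sharp h) (\<Psi> n)" for n
      by (simp only: cinner_cadjoint[OF clin_P, symmetric]) (simp only: proj SMS)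
    moreover have "synthesis \<Psi>_od (analysis (\<lambda>n. cadjoint (oblique_proj W (ker M)) (\<Psi> n))
        (M_sharp h)) = oblique_proj W ?K (M_sharp h)"
      using od by (metis comp_apply oblique_dual_frame_def)
    \<comment> \<open>A vector of \<open>W\<close> is fixed by projection onto \<open>W\<close>
      along any complement, so \<open>?K\<close> need not be identified with
      \<open>ker M\<close>.\<close>
    moreover have "oblique_proj W ?K (M_sharp h) = M_sharp h"
      using oblique_proj_eq[of W ?K "M_sharp h" 0] od W S_W csubspace_orth_compl[of "orth_compl (ker M)"]
      by (simp add: oblique_dual_frame_def csubspace_iff)
    ultimately have "M_sharp h = (\<Sum>n. cinner (M_sharp h) (\<Psi> n) *\<^sub>C \<Psi>_od n)"
      by (simp add: synthesis_def analysis_def)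
    also have "\<dots> = multiplier (\<lambda>n. 1 / m n) \<Psi>_od \<Phi>_sharp h"
      using m_nz by (simp add: multiplier_def \<Phi>_sharp_inner scaleC_scaleC)
    finally show "M_sharp h = multiplier (\<lambda>n. 1 / m n) \<Psi>_od \<Phi>_sharp h" .
  qed

  show "M_sharp = multiplier (\<lambda>n. 1 / m n) \<Psi>_sharp \<Phi>_od"
    if od: "oblique_dual_frame (orth_compl V) (range M) \<Phi>_od
      (\<lambda>n. oblique_proj (range M) V (\<Phi> n))" for \<Phi>_od
  proof
    fix h
    let ?\<pi> = "oblique_proj (range M) V"
    have R: "csubspace (range M)" and VR: "is_direct_sum (orth_compl V) (orth_compl (range M))"
      and bessel: "bessel_seq_on UNIV \<Phi>_od"
      and syn: "synthesis \<Phi>_od (analysis (\<lambda>n. ?\<pi> (\<Phi> n)) g)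
        = oblique_proj (orth_compl V) (orth_compl (range M)) g" for g
      using od by (auto simp: oblique_dual_frame_def closed_csubspace_def frame_for_def
          fun_eq_iff intro: bessel_seq_on_UNIV)
    define c where "c n = cinner h (\<Phi>_od n)" for n
    have "summable (\<lambda>n. (cmod (c n))\<^sup>2)"
      unfolding c_def using bessel_seq_on_summable[OF bessel] by simp
    then have c: "summable (\<lambda>n. c n *\<^sub>C \<Phi> n)"
      using bessel_seq_synthesis[OF assms(4)] by metis
    define u where "u = (\<Sum>n. c n *\<^sub>C \<Phi> n)"
    \<comment> \<open>The dual frame identity analyses with the projected \<open>\<Phi>\<close> and
      synthesizes with \<open>\<Phi>_od\<close>, whereas \<open>u\<close> does the reverse. Testing
      against \<open>g\<close> uses the identity in adjoint form.\<close>
    have "cinner (u - h) g = 0" if g: "g \<in> orth_compl V" for g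
    proof -
      \<comment> \<open>The oblique projection changes \<open>\<Phi> n\<close> only by an element of
        \<open>V\<close>, which \<open>g\<close> does not see.\<close>
      have eq: "cinner g (?\<pi> (\<Phi> n)) = cinner g (\<Phi> n)" for n
      proof -
        have "cinner g (\<Phi> n - ?\<pi> (\<Phi> n)) = 0"
          using g oblique_proj_diff_mem[OF R V assms(11)] by (simp add: orth_compl_def)
        then show ?thesis
          by (simp add: cinner_diff_right)
      qed
      have "summable (\<lambda>n. (cmod (cinner g (\<Phi> n)))\<^sup>2)"
        using bessel_seq_on_summable[OF assms(4)] by simp
      then have s: "summable (\<lambda>n. cinner g (\<Phi> n) *\<^sub>C \<Phi>_od n)"
        using bessel_seq_synthesis[OF bessel] by metis
      have "g = oblique_proj (orth_compl V) (orth_compl (range M)) g"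
        using oblique_proj_eq[OF csubspace_orth_compl csubspace_orth_compl VR g, of 0]
          csubspace_orth_compl[of "range M"]
        by (simp add: csubspace_iff)
      also have "\<dots> = (\<Sum>n. cinner g (\<Phi> n) *\<^sub>C \<Phi>_od n)"
        by (simp add: syn[symmetric] synthesis_def analysis_def eq)
      finally have "cinner h g = cinner h (\<Sum>n. cinner g (\<Phi> n) *\<^sub>C \<Phi>_od n)"
        by simp
      also have "\<dots> = (\<Sum>n. cinner (\<Phi> n) g * c n)"
        by (simp add: bounded_linear.suminf[OF bounded_linear_cinner_right s]
            cinner_scaleC_right c_def cinner_commute[of "\<Phi> _" g])
      also have "\<dots> = cinner u g"
        by (simp add: u_def bounded_linear.suminf[OF bounded_linear_cinner_left c]
            cinner_scaleC_left mult.commute)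
      finally show ?thesis
        by (simp add: cinner_diff_left)
    qed
    then have "u - h \<in> V"
      using orth_compl_orth_compl[OF assms(9)] by (auto simp: orth_compl_def)
    then have "M_sharp h = M_sharp u"
      using S_V[of "u - h"] by (simp add: S.diff)
    also have "\<dots> = (\<Sum>n. M_sharp (c n *\<^sub>C \<Phi> n))"
      unfolding u_def by (rule S.suminf[OF c])
    also have "\<dots> = multiplier (\<lambda>n. 1 / m n) \<Psi>_sharp \<Phi>_od h"
      using m_nz by (simp add: multiplier_def \<Psi>_sharp c_def S_scale scaleC_scaleC)
    finally show "M_sharp h = multiplier (\<lambda>n. 1 / m n) \<Psi>_sharp \<Phi>_od h" .
  qed
qed

end
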